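(* Let $H_A,H_B$ be Hilbert spaces of the same finite dimension $n$ with orthonormal bases $\{|i\rangle_A\}_{i=1}^n$, $\{|i\rangle_B\}_{i=1}^n$, let $H_E$ be a finite-dimensional Hilbert space with a fixed unit vector $|0\rangle_E$, let $U_{BE}$ be a unitary on $H_B\otimes H_E$, and put $U_{ABE}=I_A\otimes U_{BE}$. Let $|\psi_M\rangle_{AB}=\sum_{i=1}^n|i\rangle_A|i\rangle_B$. If the output state $U_{ABE}|\psi_M\rangle_{AB}|0\rangle_E$ is not $E\to B$ degradable, then the output state $U_{ABE}|\psi\rangle_{AB}|0\rangle_E$ is not $E\to B$ degradable for any input state of the form $|\psi\rangle_{AB}=(W_A\otimes I_B)|\psi_M\rangle_{AB}$ where $W_A$ is an invertible operator on $H_A$.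
   Context: A (not necessarily normalized) vector $|\tilde\psi\rangle\in H_A\otimes H_B\otimes H_E$ is called $E\to B$ degradable if there is a map $T(X)=\sum_{j=1}^r(I_A\otimes F_j)X(I_A\otimes F_j)^*$ with $F_j:H_E\to H_B$ and $\sum_{j=1}^rF_j^*F_j=I_E$ (any $r$) such that $T(\mathrm{tr}_B|\tilde\psi\rangle\langle\tilde\psi|)=\mathrm{tr}_E|\tilde\psi\rangle\langle\tilde\psi|$, where $\mathrm{tr}_B,\mathrm{tr}_E$ are the partial traces over $H_B$, $H_E$. *)

theory Defs
  imports "HOL-Analysis.Analysis"
begin

text \<open>
  A finite-dimensional complex Hilbert space is modelled as \<open>complex ^ 'a\<close> with the Hermitian inner
  product, a tensor product as the space indexed by the product of the index types, and an operator
  as its matrix with respect to the coordinate basis, acting by \<open>*v\<close>. The tripartite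
  space is \<open>complex ^ ('a \<times> 'b \<times> 'e)\<close>, bracketed as A with (B with E). The
  library norm on \<open>complex ^ 'a\<close> is the norm of the Hermitian inner product. The
  distinguished orthonormal bases of A and B are not assumed to be the coordinate bases.
\<close>

definition cinner_vec :: "complex ^ 'a \<Rightarrow> complex ^ 'a \<Rightarrow> complex" where
  "cinner_vec u v = (\<Sum>i\<in>UNIV. cnj (u $ i) * v $ i)"

definition orthonormal_basis :: "nat \<Rightarrow> (nat \<Rightarrow> complex ^ 'a) \<Rightarrow> bool" where
  "orthonormal_basis n a \<longleftrightarrow>
     (\<forall>i\<in>{1..n}. \<forall>j\<in>{1..n}. cinner_vec (a i) (a j) = (if i = j then 1 else 0)) \<and>
     vec.span (a ` {1..n}) = UNIV"

definition dagger :: "complex ^ 'a ^ 'b \<Rightarrow> complex ^ 'b ^ 'a" where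
  "dagger M = (\<chi> i j. cnj (M $ j $ i))"

definition unitary :: "complex ^ 'a ^ 'a \<Rightarrow> bool" where
  "unitary U \<longleftrightarrow> dagger U ** U = mat 1 \<and> U ** dagger U = mat 1"

definition tensor_vec :: "complex ^ 'a \<Rightarrow> complex ^ 'b \<Rightarrow> complex ^ ('a::finite \<times> 'b::finite)" where
  "tensor_vec u v = (\<chi> p. u $ fst p * v $ snd p)"

definition tensor_mat ::
  "complex ^ 'a ^ 'c \<Rightarrow> complex ^ 'b ^ 'd \<Rightarrow> complex ^ ('a::finite \<times> 'b::finite) ^ ('c::finite \<times> 'd::finite)" where
  "tensor_mat M N = (\<chi> p q. M $ fst p $ fst q * N $ snd p $ snd q)"

text \<open>The canonical identification of (A with B) with E and A with (B with E).\<close>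

definition reassoc ::
  "complex ^ (('a::finite \<times> 'b::finite) \<times> 'e::finite) \<Rightarrow> complex ^ ('a \<times> 'b \<times> 'e)" where
  "reassoc v = (\<chi> p. v $ ((fst p, fst (snd p)), snd (snd p)))"

text \<open>The operator $|\psi\rangle\langle\psi|$, for a not necessarily normalized \<open>\<psi>\<close>.\<close>

definition ketbra :: "complex ^ 'a \<Rightarrow> complex ^ 'a ^ 'a" where
  "ketbra \<psi> = (\<chi> p q. \<psi> $ p * cnj (\<psi> $ q))"

definition ptrace_B ::
  "complex ^ ('a::finite \<times> 'b::finite \<times> 'e::finite) ^ ('a \<times> 'b \<times> 'e) \<Rightarrow>
   complex ^ ('a \<times> 'e) ^ ('a \<times> 'e)" where
  "ptrace_B X = (\<chi> p q. \<Sum>j\<in>UNIV. X $ (fst p, j, snd p) $ (fst q, j, snd q))"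

definition ptrace_E ::
  "complex ^ ('a::finite \<times> 'b::finite \<times> 'e::finite) ^ ('a \<times> 'b \<times> 'e) \<Rightarrow>
   complex ^ ('a \<times> 'b) ^ ('a \<times> 'b)" where
  "ptrace_E X = (\<chi> p q. \<Sum>k\<in>UNIV. X $ (fst p, snd p, k) $ (fst q, snd q, k))"

definition kraus_map ::
  "nat \<Rightarrow> (nat \<Rightarrow> complex ^ 'e ^ 'b) \<Rightarrow> complex ^ ('a::finite \<times> 'e::finite) ^ ('a \<times> 'e) \<Rightarrow>
   complex ^ ('a \<times> 'b::finite) ^ ('a \<times> 'b)"
  where
  "kraus_map r F X =
     (\<Sum>j = 1..r. tensor_mat (mat 1) (F j) ** X ** dagger (tensor_mat (mat 1) (F j)))"

definition EB_degradable :: "complex ^ ('a::finite \<times> 'b::finite \<times> 'e::finite) \<Rightarrow> bool" where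
  "EB_degradable \<psi> \<longleftrightarrow>
     (\<exists>(r::nat) (F :: nat \<Rightarrow> complex ^ 'e ^ 'b).
        (\<Sum>j = 1..r. dagger (F j) ** F j) = mat 1 \<and>
        kraus_map r F (ptrace_B (ketbra \<psi>)) = ptrace_E (ketbra \<psi>))"

definition psi_M ::
  "nat \<Rightarrow> (nat \<Rightarrow> complex ^ 'a) \<Rightarrow> (nat \<Rightarrow> complex ^ 'b) \<Rightarrow>
   complex ^ ('a::finite \<times> 'b::finite)" where
  "psi_M n a b = (\<Sum>i = 1..n. tensor_vec (a i) (b i))"

text \<open>The output state $(I_A \otimes U_{BE})\,|\psi\rangle_{AB}|0\rangle_E$, where \<open>e0\<close> is $|0\rangle_E$.\<close>

definition output_state ::
  "complex ^ ('b::finite \<times> 'e::finite) ^ ('b \<times> 'e) \<Rightarrow> complex ^ 'e \<Rightarrow>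
   complex ^ ('a::finite \<times> 'b) \<Rightarrow> complex ^ ('a \<times> 'b \<times> 'e)"
  where
  "output_state U e0 \<psi> = tensor_mat (mat 1) U *v reassoc (tensor_vec \<psi> e0)"

end

theory Submission
  imports Defs
begin

text \<open>
  An operator \<open>V\<close> on A commutes with everything in sight: with the unitary on B and E, with both
  partial traces and with the Kraus map, which acts on E only. Hence degradability of \<open>\<phi>\<close> passes to
  \<open>(V \<otimes> I) \<phi>\<close> with the same Kraus operators, for every \<open>V\<close>. Applied to \<open>V = W\<inverse>\<close> this takes a
  degradable output for \<open>(W \<otimes> I) \<psi>\<^sub>M\<close> back to a degradable output for \<open>\<psi>\<^sub>M\<close>.
\<close>

lemma tensor_mat_mult:
  "tensor_mat A B ** tensor_mat C D = tensor_mat (A ** C) (B ** D)"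
  by (simp add: tensor_mat_def matrix_matrix_mult_def vec_eq_iff sum_product
      sum.cartesian_product split_def mult_ac flip: UNIV_Times_UNIV)

lemma tensor_mat_one: "tensor_mat (mat 1) (mat 1) = mat 1"
  by (auto simp: tensor_mat_def mat_def vec_eq_iff prod_eq_iff)

text \<open>Both products equal \<open>tensor_mat A B\<close>. Since \<open>B\<close> may be
  rectangular, the two occurrences of \<open>mat 1\<close> beside \<open>A\<close> can be identities
  on different spaces, as for a Kraus operator from E to B.\<close>

lemma tensor_mat_commute:
  "tensor_mat A (mat 1) ** tensor_mat (mat 1) B = tensor_mat (mat 1) B ** tensor_mat A (mat 1)"
  by (simp add: tensor_mat_mult)

lemma dagger_mult: "dagger (A ** B) = dagger B ** dagger A"
  by (simp add: dagger_def matrix_matrix_mult_def vec_eq_iff mult.commute)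

lemma ketbra_mult_vec: "ketbra (A *v v) = A ** ketbra v ** dagger A"
  by (simp add: ketbra_def dagger_def matrix_matrix_mult_def matrix_vector_mult_def vec_eq_iff
      sum_distrib_left sum_distrib_right mult_ac)

text \<open>Entries of \<open>mat 1\<close> in the second factor are Kronecker deltas; this
  collapses a sum over index pairs to one over the A index.\<close>

lemma sum_snd_delta:
  fixes f :: "'a::finite \<times> 'b::finite \<Rightarrow> complex"
  shows "(\<Sum>x\<in>UNIV. if snd x = k then f x else 0) = (\<Sum>i\<in>UNIV. f (i, k))"
proof -
  have "(\<Sum>x\<in>UNIV. if snd x = k then f x else 0) = (\<Sum>x | snd x = k. f x)"
    by (simp add: sum.If_cases)
  also have "\<dots> = (\<Sum>i\<in>UNIV. f (i, k))"
    by (rule sum.reindex_bij_witness[of _ "\<lambda>i. (i, k)" fst]) auto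
  finally show ?thesis .
qed

lemma tensor_mat_one_mult_vec_nth:
  "(tensor_mat V (mat 1) *v x) $ p = (\<Sum>i\<in>UNIV. V $ fst p $ i * x $ (i, snd p))"
proof -
  have "(tensor_mat V (mat 1) *v x) $ p
      = (\<Sum>q\<in>UNIV. if snd q = snd p then V $ fst p $ fst q * x $ q else 0)"
    by (auto simp: tensor_mat_def matrix_vector_mult_def mat_def intro!: sum.cong)
  then show ?thesis by (simp add: sum_snd_delta)
qed

lemma tensor_mat_one_mult_nth:
  "(tensor_mat V (mat 1) ** X) $ p $ q = (\<Sum>i\<in>UNIV. V $ fst p $ i * X $ (i, snd p) $ q)"
proof -
  have "(tensor_mat V (mat 1) ** X) $ p $ q
      = (\<Sum>r\<in>UNIV. if snd r = snd p then V $ fst p $ fst r * X $ r $ q else 0)"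
    by (auto simp: tensor_mat_def matrix_matrix_mult_def mat_def intro!: sum.cong)
  then show ?thesis by (simp add: sum_snd_delta)
qed

lemma mult_dagger_tensor_mat_one_nth:
  "(X ** dagger (tensor_mat V (mat 1))) $ p $ q
    = (\<Sum>i\<in>UNIV. X $ p $ (i, snd q) * cnj (V $ fst q $ i))"
proof -
  have "(X ** dagger (tensor_mat V (mat 1))) $ p $ q
      = (\<Sum>r\<in>UNIV. if snd r = snd q then X $ p $ r * cnj (V $ fst q $ fst r) else 0)"
    by (auto simp: tensor_mat_def dagger_def matrix_matrix_mult_def mat_def intro!: sum.cong)
  then show ?thesis by (simp add: sum_snd_delta)
qed

text \<open>\<open>V\<close> touches only the A index and the trace sums over the B index, so finite
  sums are interchanged. The identity beside \<open>V\<close> is on B with E before the trace and on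
  E after it.\<close>

lemma ptrace_B_conj:
  "ptrace_B (tensor_mat V (mat 1) ** X ** dagger (tensor_mat V (mat 1)))
    = tensor_mat V (mat 1) ** ptrace_B X ** dagger (tensor_mat V (mat 1))"
proof -
  have "(\<Sum>j\<in>UNIV. \<Sum>k\<in>UNIV. (\<Sum>i\<in>UNIV. V $ fst p $ i * X $ (i, j, snd p) $ (k, j, snd q)) * cnj (V $ fst q $ k))
      = (\<Sum>k\<in>UNIV. (\<Sum>i\<in>UNIV. V $ fst p $ i * (\<Sum>j\<in>UNIV. X $ (i, j, snd p) $ (k, j, snd q))) * cnj (V $ fst q $ k))"
    for p q
    unfolding sum_distrib_left
    \<comment> \<open>The first swap makes \<open>k\<close> the outer index on both sides; the
      second exchanges \<open>i\<close> and \<open>j\<close> on the right.\<close>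
    by (subst sum.swap, rule sum.cong[OF refl], subst sum.swap, simp only: sum_distrib_right)
  then show ?thesis
    by (simp add: ptrace_B_def vec_eq_iff tensor_mat_one_mult_nth mult_dagger_tensor_mat_one_nth)
qed

lemma ptrace_E_conj:
  "ptrace_E (tensor_mat V (mat 1) ** X ** dagger (tensor_mat V (mat 1)))
    = tensor_mat V (mat 1) ** ptrace_E X ** dagger (tensor_mat V (mat 1))"
proof -
  have "(\<Sum>j\<in>UNIV. \<Sum>k\<in>UNIV. (\<Sum>i\<in>UNIV. V $ fst p $ i * X $ (i, snd p, j) $ (k, snd q, j)) * cnj (V $ fst q $ k))
      = (\<Sum>k\<in>UNIV. (\<Sum>i\<in>UNIV. V $ fst p $ i * (\<Sum>j\<in>UNIV. X $ (i, snd p, j) $ (k, snd q, j))) * cnj (V $ fst q $ k))"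
    for p q
    unfolding sum_distrib_left
    by (subst sum.swap, rule sum.cong[OF refl], subst sum.swap, simp only: sum_distrib_right)
  then show ?thesis
    by (simp add: ptrace_E_def vec_eq_iff tensor_mat_one_mult_nth mult_dagger_tensor_mat_one_nth)
qed

lemma sum_matrix_mult_left: "A ** (\<Sum>i\<in>I. f i) = (\<Sum>i\<in>I. A ** f i)"
  for A :: "'r::semiring_1 ^ 'n ^ 'm"
  by (induction I rule: infinite_finite_induct) (simp_all add: matrix_add_ldistrib)

lemma sum_matrix_mult_right: "(\<Sum>i\<in>I. f i) ** A = (\<Sum>i\<in>I. f i ** A)"
  for A :: "'r::semiring_1 ^ 'n ^ 'm"
  by (induction I rule: infinite_finite_induct) (simp_all add: matrix_matrix_mult_def vec_eq_iff distrib_right sum.distrib)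

lemma kraus_map_conj:
  fixes F :: "nat \<Rightarrow> complex ^ 'e::finite ^ 'b::finite"
  shows "kraus_map r F (tensor_mat V (mat 1) ** X ** dagger (tensor_mat V (mat 1)))
    = tensor_mat V (mat 1) ** kraus_map r F X ** dagger (tensor_mat V (mat 1))"
proof -
  have "tensor_mat (mat 1) G ** (tensor_mat V (mat 1) ** X ** dagger (tensor_mat V (mat 1)))
      ** dagger (tensor_mat (mat 1) G)
    = tensor_mat V (mat 1) ** (tensor_mat (mat 1) G ** X ** dagger (tensor_mat (mat 1) G))
      ** dagger (tensor_mat V (mat 1))" for G :: "complex ^ 'e ^ 'b"
  proof -
    \<comment> \<open>Regrouping puts the same product of \<open>G\<close> and \<open>V\<close> on
      the left and under a single \<open>dagger\<close> on the right, so one commutation rule serves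
      both sides.\<close>
    have "tensor_mat (mat 1) G ** (tensor_mat V (mat 1) ** X ** dagger (tensor_mat V (mat 1)))
        ** dagger (tensor_mat (mat 1) G)
      = (tensor_mat (mat 1) G ** tensor_mat V (mat 1)) ** X
        ** dagger (tensor_mat (mat 1) G ** tensor_mat V (mat 1))"
      by (simp add: dagger_mult matrix_mul_assoc)
    also have "\<dots> = (tensor_mat V (mat 1) ** tensor_mat (mat 1) G) ** X
        ** dagger (tensor_mat V (mat 1) ** tensor_mat (mat 1) G)"
      by (simp only: tensor_mat_commute)
    finally show ?thesis by (simp add: dagger_mult matrix_mul_assoc)
  qed
  then show ?thesis
    by (simp add: kraus_map_def sum_matrix_mult_left sum_matrix_mult_right)
qed

text \<open>\<open>EB_degradable\<close> asks for no normalization, so the image under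
  \<open>V\<close> needs no rescaling.\<close>

lemma EB_degradable_local_A:
  assumes "EB_degradable \<phi>"
  shows "EB_degradable (tensor_mat V (mat 1) *v \<phi>)"
proof -
  from assms obtain r F where F: "(\<Sum>j = 1..r. dagger (F j) ** F j) = mat 1"
    and eq: "kraus_map r F (ptrace_B (ketbra \<phi>)) = ptrace_E (ketbra \<phi>)"
    unfolding EB_degradable_def by blast
  have "kraus_map r F (ptrace_B (ketbra (tensor_mat V (mat 1) *v \<phi>)))
      = ptrace_E (ketbra (tensor_mat V (mat 1) *v \<phi>))"
    by (simp only: ketbra_mult_vec ptrace_B_conj ptrace_E_conj kraus_map_conj eq)
  with F show ?thesis unfolding EB_degradable_def by blast
qed

text \<open>The identity beside \<open>V\<close> grows from B to B with E under the
  rebracketing.\<close>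

lemma reassoc_local_A:
  "reassoc (tensor_vec (tensor_mat V (mat 1) *v \<psi>) e)
    = tensor_mat V (mat 1) *v reassoc (tensor_vec \<psi> e)"
  by (simp add: vec_eq_iff reassoc_def tensor_vec_def tensor_mat_one_mult_vec_nth
      sum_distrib_left sum_distrib_right mult_ac)

lemma output_state_local_A:
  "output_state U e (tensor_mat V (mat 1) *v \<psi>) = tensor_mat V (mat 1) *v output_state U e \<psi>"
  by (simp add: output_state_def reassoc_local_A matrix_vector_mul_assoc tensor_mat_commute)

theorem theorem5p4:
  fixes n :: nat
    and a :: "nat \<Rightarrow> complex ^ 'a"
    and b :: "nat \<Rightarrow> complex ^ 'b"
    and e0 :: "complex ^ 'e"
    and U :: "complex ^ ('b::finite \<times> 'e::finite) ^ ('b \<times> 'e)"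
  assumes "CARD('a) = n" and "CARD('b) = n"
    and "orthonormal_basis n a" and "orthonormal_basis n b"
    and "norm e0 = 1"
    and "unitary U"
    and "\<not> EB_degradable (output_state U e0 (psi_M n a b))"
  shows "\<forall>W :: complex ^ 'a ^ 'a. invertible W \<longrightarrow>
           \<not> EB_degradable (output_state U e0 (tensor_mat W (mat 1) *v psi_M n a b))"
proof (intro allI impI notI)
  fix W :: "complex ^ 'a ^ 'a"
  assume "invertible W"
  then obtain V where V: "V ** W = mat 1"
    unfolding invertible_def by blast
  assume "EB_degradable (output_state U e0 (tensor_mat W (mat 1) *v psi_M n a b))"
  then have "EB_degradable
      (output_state U e0 (tensor_mat V (mat 1) *v (tensor_mat W (mat 1) *v psi_M n a b)))"
    \<comment> \<open>Fixing \<open>V\<close> pulls only \<open>V\<close> out of the output state;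
      \<open>W\<close> stays inside, as in the degradable state assumed.\<close>
    unfolding output_state_local_A[of U e0 V] by (rule EB_degradable_local_A)
  \<comment> \<open>\<open>V ** W = mat 1\<close> reduces the input to
    \<open>psi_M n a b\<close>.\<close>
  with assms(7) show False
    by (simp add: matrix_vector_mul_assoc tensor_mat_mult V tensor_mat_one)
qed

end
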